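(* Let $n\ge1$ and let $\vec x=(x_1,\dots,x_n)$, $\vec y=(y_1,\dots,y_n)$ be vectors in $\mathbb C^n$. If $\vec x\ne\vec0$, then the linear deviation of $\vec x$ from $\vec y$ is $$d(\mathbb C^*\vec x,\vec y)=\sqrt{\|\vec y\|^2-\frac{|\langle\vec x|\vec y\rangle|^2}{\|\vec x\|^2}}=d(a\vec x,\vec y),\qquad\text{where } a=\frac{\overline{\langle\vec x|\vec y\rangle}}{\|\vec x\|^2}.$$ If $\vec x=\vec0$, then $d(\mathbb C^*\vec x,\vec y)=\|\vec y\|$.
   Context: $\mathbb C^*=\mathbb C\setminus\{0\}$. For $\vec x,\vec y\in\mathbb C^n$: $\langle\vec x|\vec y\rangle=\sum_{k=1}^nx_k\overline{y_k}$, $\|\vec x\|=\sqrt{\langle\vec x|\vec x\rangle}$, $d(\vec x,\vec y)=\|\vec x-\vec y\|$. The linear deviation is $d(\mathbb C^*\vec x,\vec y)=\inf\{d(a\vec x,\vec y):a\in\mathbb C^*\}$. *)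

theory Defs
  imports "HOL-Analysis.Analysis"
begin

definition herm_inner :: "complex ^ 'n \<Rightarrow> complex ^ 'n \<Rightarrow> complex"
  where "herm_inner x y = (\<Sum>k\<in>UNIV. x $ k * cnj (y $ k))"

text \<open>
  The library's \<^term>\<open>norm\<close> and \<^term>\<open>dist\<close> on \<^typ>\<open>complex ^ 'n\<close> are the ones
  induced by this Hermitian form.
\<close>

lemma herm_inner_self: "herm_inner x x = complex_of_real ((norm x)\<^sup>2)"
  by (simp add: herm_inner_def norm_vec_def L2_set_def sum_nonneg complex_norm_square
      del: of_real_power)

lemma norm_eq_sqrt_herm_inner: "norm x = sqrt (Re (herm_inner x x))"
  by (simp add: herm_inner_self del: of_real_power)

lemma dist_eq_sqrt_herm_inner:
  fixes x y :: "complex ^ 'n"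
  shows "dist x y = sqrt (Re (herm_inner (x - y) (x - y)))"
  by (simp add: dist_norm norm_eq_sqrt_herm_inner)

definition linear_deviation :: "complex ^ 'n \<Rightarrow> complex ^ 'n \<Rightarrow> real"
  where "linear_deviation x y = (INF a\<in>UNIV - {0}. dist (a *s x) y)"

end

theory Submission
  imports Defs
begin

text \<open>
  Write \<open>h\<close> for \<open>herm_inner x y\<close>. Completing the square in the complex variable \<open>a\<close> gives,
  for \<open>x \<noteq> 0\<close>,
  \<open>(dist (a *s x) y)\<^sup>2 = (norm x)\<^sup>2 * (cmod (a - a0))\<^sup>2 + ((norm y)\<^sup>2 - (cmod h)\<^sup>2 / (norm x)\<^sup>2)\<close>
  with \<open>a0 = cnj h / (norm x)\<^sup>2\<close> (lemma \<open>dist_scaled_power2\<close>). Hence \<open>a0\<close> minimises the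
  distance over all complex scalars, and the minimum can be read off.

  The infimum, however, runs only over nonzero scalars, and \<open>a0 = 0\<close> when \<open>x\<close> and \<open>y\<close> are
  orthogonal; the infimum is then not attained. Its value is still the minimum over all scalars,
  because the distance depends continuously on the scalar and the nonzero scalars are dense
  (lemma \<open>cINF_dense_eq_minimum\<close>). The case \<open>x = 0\<close> is that of a constant distance.
\<close>

text \<open>
  By continuity a lower bound on a dense set is a lower bound everywhere, so restricting to the
  dense set cannot raise the infimum above the global minimum.
\<close>

lemma cINF_dense_eq_minimum:
  fixes f :: "'a::topological_space \<Rightarrow> real"
  assumes cont: "continuous_on UNIV f"
    and dense: "closure S = UNIV"
    and min: "\<And>a. f m \<le> f a"
  shows "(INF a\<in>S. f a) = f m"
proof (rule antisym)
  have "S \<noteq> {}"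
    using dense by auto
  then show "f m \<le> (INF a\<in>S. f a)"
    by (rule cINF_greatest) (rule min)
  have "bdd_below (f ` S)"
    using min by (rule bdd_belowI2)
  then have "(INF a\<in>S. f a) \<le> f a" if "a \<in> S" for a
    using that by (rule cINF_lower)
  then show "(INF a\<in>S. f a) \<le> f m"
    using continuous_ge_on_closure[of S f m] cont dense by simp
qed

lemma linear_deviation_eq_dist_minimizer:
  fixes x y :: "complex ^ 'n"
  assumes "\<And>a. dist (m *s x) y \<le> dist (a *s x) y"
  shows "linear_deviation x y = dist (m *s x) y"
  unfolding linear_deviation_def
proof (rule cINF_dense_eq_minimum)
  show "continuous_on UNIV (\<lambda>a. dist (a *s x) y)"
    unfolding vector_scalar_mult_def by (intro continuous_intros)
  show "closure (UNIV - {0 :: complex}) = UNIV"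
    by (simp add: closure_complement flip: Compl_eq_Diff_UNIV)
qed (rule assms)

lemma herm_inner_scaled_diff_self:
  fixes x y :: "complex ^ 'n"
  shows "herm_inner (a *s x - y) (a *s x - y)
    = a * cnj a * herm_inner x x - a * herm_inner x y - cnj (a * herm_inner x y)
      + herm_inner y y"
  unfolding herm_inner_def
  by (simp add: algebra_simps sum.distrib sum_subtractf sum_distrib_left)

text \<open>The square is completed at the scalar of the orthogonal projection of \<open>y\<close> onto \<open>x\<close>.\<close>

lemma dist_scaled_power2:
  fixes x y :: "complex ^ 'n"
  assumes "x \<noteq> 0"
  shows "(dist (a *s x) y)\<^sup>2
    = (norm x)\<^sup>2 * (cmod (a - cnj (herm_inner x y) / complex_of_real ((norm x)\<^sup>2)))\<^sup>2
      + ((norm y)\<^sup>2 - (cmod (herm_inner x y))\<^sup>2 / (norm x)\<^sup>2)"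
proof -
  define N where "N = (norm x)\<^sup>2"
  define h where "h = herm_inner x y"
  have N: "complex_of_real N \<noteq> 0"
    using assms by (simp add: N_def)
  have "complex_of_real ((dist (a *s x) y)\<^sup>2)
      = a * cnj a * of_real N - a * h - cnj (a * h) + of_real ((norm y)\<^sup>2)"
    unfolding dist_norm herm_inner_self[symmetric] herm_inner_scaled_diff_self N_def h_def ..
  also have "\<dots> = of_real N * ((a - cnj h / of_real N) * cnj (a - cnj h / of_real N))
      + (of_real ((norm y)\<^sup>2) - h * cnj h / of_real N)"
    using N by (simp add: field_simps)
  also have "\<dots> = complex_of_real (N * (cmod (a - cnj h / of_real N))\<^sup>2
      + ((norm y)\<^sup>2 - (cmod h)\<^sup>2 / N))"
    by (simp only: of_real_add of_real_diff of_real_mult of_real_divide complex_norm_square)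
  finally show ?thesis
    unfolding of_real_eq_iff N_def h_def .
qed

theorem theorem3:
  fixes x y :: "complex ^ 'n"
  shows "(x \<noteq> 0 \<longrightarrow>
           linear_deviation x y
             = sqrt ((norm y)\<^sup>2 - (cmod (herm_inner x y))\<^sup>2 / (norm x)\<^sup>2)
         \<and> linear_deviation x y
             = dist ((cnj (herm_inner x y) / complex_of_real ((norm x)\<^sup>2)) *s x) y)
       \<and> (x = 0 \<longrightarrow> linear_deviation x y = norm y)"
proof (intro conjI[of "_ \<longrightarrow> _"] impI)
  assume x: "x \<noteq> 0"
  define m where "m = cnj (herm_inner x y) / complex_of_real ((norm x)\<^sup>2)"
  define r where "r = (norm y)\<^sup>2 - (cmod (herm_inner x y))\<^sup>2 / (norm x)\<^sup>2"
  have sq: "(dist (a *s x) y)\<^sup>2 = (norm x)\<^sup>2 * (cmod (a - m))\<^sup>2 + r" for a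
    unfolding m_def r_def using x by (rule dist_scaled_power2)
  have at_m: "(dist (m *s x) y)\<^sup>2 = r"
    by (simp add: sq)
  have "(dist (m *s x) y)\<^sup>2 \<le> (dist (a *s x) y)\<^sup>2" for a
    unfolding at_m sq[of a] by simp
  then have "dist (m *s x) y \<le> dist (a *s x) y" for a
    by (rule power2_le_imp_le) simp
  then have "linear_deviation x y = dist (m *s x) y"
    by (rule linear_deviation_eq_dist_minimizer)
  moreover have "dist (m *s x) y = sqrt r"
    unfolding at_m[symmetric] by simp
  ultimately show "linear_deviation x y = sqrt r \<and> linear_deviation x y = dist (m *s x) y"
    by simp
next
  assume "x = 0"
  then show "linear_deviation x y = norm y"
    using linear_deviation_eq_dist_minimizer[of 0 x y] by simp
qed

end
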